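(* Let $n\ge 1$ and let $K_{1,n}$ be the star with $n$ leaves. When $n$ is odd, $\chi_g^\infty(K_{1,n}) \geq \lceil \frac{n}{2} \rceil + 2$. When $n \geq 4$ is even, $\chi_g^\infty(K_{1,n}) \geq \frac{n}{2}+3$.
   Context: The eternal vertex coloring game (A-game) on a finite undirected graph $G$ with color set $\{1,\ldots,k\}$: all vertices are initially uncolored. Alice and Bob strictly alternate turns, Alice moving first overall. On a turn the player chooses one vertex. If it is uncolored, the player must give it a color not currently used on any of its neighbors; if it currently has color $c$, the player must change its color to a color different from $c$ that is not currently used on any of its neighbors. The player whose turn it is picks the vertex and the new color. Play proceeds in rounds: every vertex must be chosen $t$ times before any vertex is chosen $t+1$ times, for every integer $t\ge 1$ (so each vertex is chosen exactly once per round; turns keep alternating across rounds, so if $|V(G)|$ is odd Bob moves first in even-numbered rounds). If some player chooses a vertex $v$ (still available in the current round) that cannot be legally colored, i.e. every color in the color set other than the current color of $v$ (if any) appears on a neighbor of $v$, then Bob wins. In particular Bob may deliberately choose such a vertex. Alice wins if this never happens (the game goes on forever). The eternal game chromatic number $\chi_g^\infty(G)$ is the minimum $k$ such that Alice has a winning strategy on $G$ with $k$ colors. *)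

theory Defs
  imports Complex_Main "Graph_Theory.Graph_Theory"
begin

(* Undirected graphs are the symmetric digraphs of Graph_Theory (locale graph: finite, no loops,
   no parallel arcs); adjacency is the relation u \<rightarrow>\<^bsub>G\<^esub> v.

   A history is the list of moves (vertex, new colour) played so far, the most recent move first.
   Hence map_of h is the current partial colouring, and Alice, who moves first, is on turn exactly
   when the length of the history is even. *)

type_synonym 'a history = "('a \<times> nat) list"

definition times_chosen :: "'a history \<Rightarrow> 'a \<Rightarrow> nat" where
  "times_chosen h v = count_list (map fst h) v"

(* Rounds: no vertex is chosen a (t+1)-st time before every vertex has been chosen t times. *)
definition available :: "('a, 'b) pre_digraph \<Rightarrow> 'a history \<Rightarrow> 'a \<Rightarrow> bool" where
  "available G h v \<longleftrightarrow> v \<in> verts G \<and> (\<forall>u \<in> verts G. times_chosen h v \<le> times_chosen h u)"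

definition legal_colour :: "('a, 'b) pre_digraph \<Rightarrow> nat \<Rightarrow> 'a history \<Rightarrow> 'a \<Rightarrow> nat \<Rightarrow> bool" where
  "legal_colour G k h v c \<longleftrightarrow>
     c \<in> {1..k} \<and> map_of h v \<noteq> Some c \<and> (\<forall>u. u \<rightarrow>\<^bsub>G\<^esub> v \<longrightarrow> map_of h u \<noteq> Some c)"

definition legal_move :: "('a, 'b) pre_digraph \<Rightarrow> nat \<Rightarrow> 'a history \<Rightarrow> 'a \<times> nat \<Rightarrow> bool" where
  "legal_move G k h m \<longleftrightarrow> available G h (fst m) \<and> legal_colour G k h (fst m) (snd m)"

(* A vertex whose choice at this point makes Bob win, whoever chooses it. *)
definition blocked :: "('a, 'b) pre_digraph \<Rightarrow> nat \<Rightarrow> 'a history \<Rightarrow> 'a \<Rightarrow> bool" where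
  "blocked G k h v \<longleftrightarrow> available G h v \<and> \<not> (\<exists>c. legal_colour G k h v c)"

abbreviation Alice_to_move :: "'a history \<Rightarrow> bool" where
  "Alice_to_move h \<equiv> even (length h)"

(* The histories that can arise, without the game having ended, when Alice follows her strategy s
   and Bob plays arbitrarily. *)
inductive consistent ::
  "('a, 'b) pre_digraph \<Rightarrow> nat \<Rightarrow> ('a history \<Rightarrow> 'a \<times> nat) \<Rightarrow> 'a history \<Rightarrow> bool"
  for G k s where
  start: "consistent G k s []"
| Alice: "consistent G k s h \<Longrightarrow> Alice_to_move h \<Longrightarrow> legal_move G k h (s h)
            \<Longrightarrow> consistent G k s (s h # h)"
| Bob: "consistent G k s h \<Longrightarrow> \<not> Alice_to_move h \<Longrightarrow> legal_move G k h m
            \<Longrightarrow> consistent G k s (m # h)"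

(* Bob never gets the opportunity to choose a blocked vertex, and Alice never chooses one herself:
   her prescribed move is always legal, so its vertex is not blocked. *)
definition winning_strategy ::
  "('a, 'b) pre_digraph \<Rightarrow> nat \<Rightarrow> ('a history \<Rightarrow> 'a \<times> nat) \<Rightarrow> bool" where
  "winning_strategy G k s \<longleftrightarrow>
     (\<forall>h. consistent G k s h \<longrightarrow>
        (if Alice_to_move h then legal_move G k h (s h) else \<not> (\<exists>v. blocked G k h v)))"

(* The minimum exists for every finite graph with at least one vertex: with (maximum degree) + 2
   colours no vertex is ever blocked. *)
definition eternal_game_chromatic_number :: "('a, 'b) pre_digraph \<Rightarrow> nat" where
  "eternal_game_chromatic_number G = (LEAST k. \<exists>s. winning_strategy G k s)"

end

theory Submission
  imports Defs
begin

text \<open>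
  The centre of the star is blocked as soon as every colour other than its own occurs on a leaf,
  so Bob aims at such a position.  Let \<open>k\<close> be below the claimed bound.  In the first round he always puts a new colour on a leaf, which
  leaves at most \<open>k - 1 - \<lceil>n / 2\<rceil>\<close> colours unused at its end.

  If \<open>n\<close> is odd, no colour is unused and Alice is on turn.  She has to destroy the last copy of
  some colour \<open>c\<close>, and Bob replies by giving \<open>c\<close> to a leaf whose own colour occurs elsewhere; a count
  of the leaves not yet chosen in this round shows that such a leaf always exists.

  If \<open>n\<close> is even, Bob is on turn and at most one colour is unused.  He gives it to the centre and
  spends the second round on putting all other colours on the leaves, so that Alice starts the
  third round in the position of the odd case.  This fails only for \<open>n = 4\<close> and leaves coloured
  \<open>a, a, a, b\<close>; there Bob first recolours \<open>b\<close> to \<open>a\<close>.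
\<close>

subsection \<open>The game on partial colourings\<close>

text \<open>Legality depends on the history only through the current colouring, so the game can be
  analysed on partial colourings.\<close>

definition colour_ok :: "('a, 'b) pre_digraph \<Rightarrow> nat \<Rightarrow> ('a \<rightharpoonup> nat) \<Rightarrow> 'a \<Rightarrow> nat \<Rightarrow> bool" where
  "colour_ok G k f v c \<longleftrightarrow>
     c \<in> {1..k} \<and> f v \<noteq> Some c \<and> (\<forall>u. u \<rightarrow>\<^bsub>G\<^esub> v \<longrightarrow> f u \<noteq> Some c)"

text \<open>\<open>A\<close> stands for the vertices not yet chosen in the current round. Choosing
  the last of them opens a new round, in which all vertices are available again.\<close>

definition remaining :: "('a, 'b) pre_digraph \<Rightarrow> 'a set \<Rightarrow> 'a \<Rightarrow> 'a set" where
  "remaining G A v = (if A \<subseteq> {v} then verts G else A - {v})"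

text \<open>The Boolean says whether Alice is on turn. The least fixed point expresses that Bob
  forces a win in finitely many moves. Alice's choices of blocked vertices lose at once, so the rule
  \<open>Alice\<close> ranges over legal moves only; it applies vacuously when she has none.\<close>

inductive bob_wins ::
  "('a, 'b) pre_digraph \<Rightarrow> nat \<Rightarrow> bool \<Rightarrow> 'a set \<Rightarrow> ('a \<rightharpoonup> nat) \<Rightarrow> bool"
  for G k where
  blocked: "v \<in> A \<Longrightarrow> \<nexists>c. colour_ok G k f v c \<Longrightarrow> bob_wins G k False A f"
| Bob: "v \<in> A \<Longrightarrow> colour_ok G k f v c \<Longrightarrow> bob_wins G k True (remaining G A v) (f(v \<mapsto> c))
          \<Longrightarrow> bob_wins G k False A f"
| Alice: "(\<And>v c. v \<in> A \<Longrightarrow> colour_ok G k f v c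
            \<Longrightarrow> bob_wins G k False (remaining G A v) (f(v \<mapsto> c)))
          \<Longrightarrow> bob_wins G k True A f"

lemma legal_colour_eq: "legal_colour G k h v c \<longleftrightarrow> colour_ok G k (map_of h) v c"
  by (simp add: legal_colour_def colour_ok_def)

lemma times_chosen_Cons:
  "times_chosen (m # h) v = (if fst m = v then Suc (times_chosen h v) else times_chosen h v)"
  by (simp add: times_chosen_def)

text \<open>Only a vertex with the minimal count can be chosen, so no count runs ahead of another by
  more than one.\<close>

lemma consistent_balanced:
  assumes "consistent G k s h" "u \<in> verts G" "v \<in> verts G"
  shows "times_chosen h v \<le> Suc (times_chosen h u)"
  using assms
proof (induction arbitrary: u v)
  case start
  then show ?case by (simp add: times_chosen_def)
next
  case (Alice h)
  then have "available G h (fst (s h))" by (simp add: legal_move_def)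
  with Alice.IH[of u v] Alice.prems show ?case
    by (auto simp: available_def times_chosen_Cons)
next
  case (Bob h m)
  then have "available G h (fst m)" by (simp add: legal_move_def)
  with Bob.IH[of u v] Bob.prems show ?case
    by (auto simp: available_def times_chosen_Cons)
qed

text \<open>This links the counts of the history to the sets of \<open>remaining\<close>. If
  \<open>v\<close> is the only vertex with the minimal count, all others are exactly one ahead by
  \<open>consistent_balanced\<close>, and choosing \<open>v\<close> levels all counts.\<close>

lemma available_Cons:
  assumes "consistent G k s h" "available G h v"
  shows "Collect (available G ((v, c) # h)) = remaining G (Collect (available G h)) v"
proof (cases "Collect (available G h) \<subseteq> {v}")
  case True
  have v: "v \<in> verts G" and min: "\<And>u. u \<in> verts G \<Longrightarrow> times_chosen h v \<le> times_chosen h u"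
    using assms(2) by (auto simp: available_def)
  have less: "times_chosen h v < times_chosen h u" if "u \<in> verts G" "u \<noteq> v" for u
  proof (rule ccontr)
    assume "\<not> ?thesis"
    with min have "available G h u"
      using that unfolding available_def by (meson le_trans not_less)
    with True that show False by blast
  qed
  have eq: "times_chosen h u = Suc (times_chosen h v)" if "u \<in> verts G" "u \<noteq> v" for u
    using consistent_balanced[OF assms(1) v that(1)] less[OF that] by simp
  have "Collect (available G ((v, c) # h)) = verts G"
    using v eq by (auto simp: available_def times_chosen_Cons)
  with True show ?thesis by (simp add: remaining_def)
next
  case False
  then obtain w where w: "available G h w" "w \<noteq> v" by auto
  have "available G ((v, c) # h) u \<longleftrightarrow> available G h u \<and> u \<noteq> v" for u
  proof
    assume *: "available G ((v, c) # h) u"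
    then have "times_chosen ((v, c) # h) u \<le> times_chosen ((v, c) # h) w"
      using w by (simp add: available_def)
    with w assms(2) have u: "u \<noteq> v"
      by (fastforce simp: times_chosen_Cons available_def)
    moreover have "available G h u"
      using * u w assms(2) unfolding available_def times_chosen_Cons
      by (smt (verit) fst_conv le_trans)
    ultimately show "available G h u \<and> u \<noteq> v" by simp
  next
    assume "available G h u \<and> u \<noteq> v"
    then show "available G ((v, c) # h) u"
      by (auto simp: available_def times_chosen_Cons intro: le_SucI)
  qed
  with False show ?thesis by (auto simp: remaining_def)
qed

text \<open>A derivation of \<open>bob_wins\<close> is a strategy tree for Bob. Playing it against
  \<open>s\<close> builds a consistent history that ends where Bob can choose a blocked vertex or
  where the move of \<open>s\<close> is illegal.\<close>

lemma bob_wins_sound: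
  assumes "bob_wins G k t A f" and "winning_strategy G k s"
    and "consistent G k s h" "t = Alice_to_move h" "A = Collect (available G h)" "f = map_of h"
  shows False
  using assms(1,3-6)
proof (induction arbitrary: h)
  case (blocked v A f)
  then have "blocked G k h v"
    by (simp add: blocked_def legal_colour_eq)
  with blocked assms(2) show ?case
    by (auto simp: winning_strategy_def)
next
  case (Bob v A f c)
  then have v: "available G h v" by simp
  with Bob have "consistent G k s ((v, c) # h)"
    by (auto intro!: consistent.Bob simp: legal_move_def legal_colour_eq)
  with Bob.prems show ?case
    by (intro Bob.IH[of "(v, c) # h"]) (auto simp: available_Cons[OF Bob.prems(1) v, of c])
next
  case (Alice A f)
  then have legal: "legal_move G k h (s h)"
    using assms(2) by (auto simp: winning_strategy_def)
  obtain v c where vc: "s h = (v, c)" by fastforce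
  from legal have v: "available G h v" and "colour_ok G k (map_of h) v c"
    by (auto simp: legal_move_def legal_colour_eq vc)
  moreover have "consistent G k s ((v, c) # h)"
    using consistent.Alice[OF Alice.prems(1) _ legal] Alice.prems vc by simp
  ultimately show ?case
    using Alice.prems
    by (intro Alice.IH[of v c "(v, c) # h"])
      (auto simp: available_Cons[OF Alice.prems(1) v, of c])
qed

lemma available_Nil: "Collect (available G []) = verts G"
  by (auto simp: available_def times_chosen_def)

lemma no_winning_strategy:
  assumes "bob_wins G k True (verts G) Map.empty"
  shows "\<not> winning_strategy G k s"
  using bob_wins_sound[OF assms _ consistent.start] available_Nil by fastforce

section \<open>The minimum defining the game chromatic number is attained\<close>

lemma ex_available:
  assumes "finite (verts G)" "verts G \<noteq> {}"
  shows "\<exists>v. available G h v"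
proof -
  from ex_is_arg_min_if_finite[OF assms] obtain v
    where "is_arg_min (times_chosen h) (\<lambda>v. v \<in> verts G) v" by blast
  then show ?thesis
    by (auto simp: is_arg_min_linorder available_def)
qed

text \<open>With one colour more than there are vertices, some colour is absent from the whole
  graph, hence legal everywhere, and Alice may play any legal move.\<close>

lemma ex_winning_strategy:
  assumes "graph G" "verts G \<noteq> {}"
  shows "\<exists>k s. winning_strategy G k s"
proof -
  interpret graph G by fact
  let ?k = "Suc (card (verts G))"
  have ok: "\<exists>c. legal_colour G ?k h v c" if "v \<in> verts G" for h v
  proof -
    let ?F = "{c. Some c \<in> map_of h ` verts G}"
    have "Some ` ?F \<subseteq> map_of h ` verts G" by auto
    then have "card (Some ` ?F) \<le> card (verts G)"
      by (meson card_image_le card_mono finite_imageI finite_verts le_trans)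
    then have "card ?F \<le> card (verts G)"
      by (simp add: card_image)
    moreover have "finite ?F"
      by (rule finite_imageD[of Some]) (auto intro: finite_subset[of _ "map_of h ` verts G"])
    ultimately have "\<not> {1..?k} \<subseteq> ?F"
      by (metis card_atLeastAtMost card_mono diff_Suc_1 not_less_eq_eq)
    then obtain c where "c \<in> {1..?k}" "Some c \<notin> map_of h ` verts G" by blast
    with that have "legal_colour G ?k h v c"
      unfolding legal_colour_def by (metis adj_in_verts(1) imageI)
    then show ?thesis ..
  qed
  have "winning_strategy G ?k (\<lambda>h. SOME m. legal_move G ?k h m)"
    unfolding winning_strategy_def
  proof (intro allI impI, split if_split, intro conjI impI)
    fix h
    obtain v where v: "available G h v"
      using ex_available[of G h] assms by auto
    with ok[of v h] obtain c where "legal_move G ?k h (v, c)"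
      by (auto simp: legal_move_def available_def)
    then show "legal_move G ?k h (SOME m. legal_move G ?k h m)" by (rule someI)
  next
    fix h
    show "\<nexists>v. blocked G ?k h v"
      using ok by (auto simp: blocked_def available_def)
  qed
  then show ?thesis by blast
qed

lemma chromatic_number_geI:
  assumes "graph G" "verts G \<noteq> {}"
    and "\<And>k. k < m \<Longrightarrow> bob_wins G k True (verts G) Map.empty"
  shows "m \<le> eternal_game_chromatic_number G"
proof -
  obtain k where "\<exists>s. winning_strategy G k s"
    using ex_winning_strategy[OF assms(1,2)] by blast
  then have "\<exists>s. winning_strategy G (eternal_game_chromatic_number G) s"
    unfolding eternal_game_chromatic_number_def by (rule LeastI)
  with assms(3) no_winning_strategy show ?thesis
    by (metis not_le)
qed

subsection \<open>Bob's strategy on stars\<close>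

locale star =
  fixes G :: "('a, 'b) pre_digraph" and k :: nat and x :: 'a and L :: "'a set"
  assumes verts_eq: "verts G = insert x L" and center: "x \<notin> L" and fin: "finite L"
    and adj: "u \<rightarrow>\<^bsub>G\<^esub> v \<longleftrightarrow> u = x \<and> v \<in> L \<or> u \<in> L \<and> v = x"
begin

abbreviation "V \<equiv> insert x L"
abbreviation "wins \<equiv> bob_wins G k"
abbreviation "ok \<equiv> colour_ok G k"
abbreviation "rest \<equiv> remaining G"

text \<open>For \<open>S = V\<close> these are the legal new colours of the centre, see
  \<open>ok_center\<close>. For smaller \<open>S\<close>, consisting of the vertices already settled
  in this round, they are the colours not yet secured until its end.\<close>

definition unused :: "('a \<rightharpoonup> nat) \<Rightarrow> 'a set \<Rightarrow> nat set" where
  "unused f S = {c \<in> {1..k}. Some c \<notin> f ` S}"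

lemma unused_iff: "c \<in> unused f S \<longleftrightarrow> c \<in> {1..k} \<and> (\<forall>v \<in> S. f v \<noteq> Some c)"
  by (auto simp: unused_def image_iff)

lemma finite_unused [simp]: "finite (unused f S)"
  by (simp add: unused_def)

lemma ok_leaf: "v \<in> L \<Longrightarrow> ok f v c \<longleftrightarrow> c \<in> {1..k} \<and> f v \<noteq> Some c \<and> f x \<noteq> Some c"
  using center by (auto simp: colour_ok_def adj)

lemma ex_ok_leaf:
  assumes "3 \<le> k" "v \<in> L"
  shows "\<exists>c. ok f v c"
proof -
  \<comment> \<open>For an uncoloured vertex \<open>the None\<close> is some unspecified number,
    which at worst excludes one colour too many.\<close>
  let ?B = "{the (f v), the (f x)}"
  have "card ?B \<le> 2" by (simp add: card_insert_if)
  then have "\<not> {1..k} \<subseteq> ?B" using assms(1) card_mono[of ?B "{1..k}"] by auto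
  then obtain c where "c \<in> {1..k}" "c \<noteq> the (f v)" "c \<noteq> the (f x)" by blast
  then have "ok f v c" using assms(2) by (auto simp: ok_leaf)
  then show ?thesis ..
qed

lemma ok_center: "ok f x c \<longleftrightarrow> c \<in> unused f V"
  using center by (auto simp: colour_ok_def adj unused_def image_iff)

lemma center_blocked: "x \<in> A \<Longrightarrow> unused f V = {} \<Longrightarrow> wins False A f"
  by (rule blocked) (auto simp: ok_center)

lemma rest_eq: "w \<in> A \<Longrightarrow> w \<noteq> v \<Longrightarrow> rest A v = A - {v}"
  by (auto simp: remaining_def)

lemma rest_singleton: "rest {v} v = V"
  by (auto simp: remaining_def verts_eq)

section \<open>Alice on turn while all colours are in use\<close>

text \<open>
  \<open>unused f (V - (A - {x}))\<close> consists of the colours that occur neither on the centre nor on a leaf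
  already chosen in this round.  An exchange of moves uses up two available leaves and at least one
  of these colours; the first exchange of a round uses up two, which accounts for the bonus 2.
\<close>

lemma wins_all_colours:
  assumes "x \<in> A" "A \<subseteq> V" "f ` L \<subseteq> Some ` {1..k}" "unused f V = {}"
    and "2 * card (unused f (V - (A - {x}))) \<le> card (A - {x}) + (if L \<subseteq> A then 2 else 0)"
  shows "wins True A f"
  using assms
proof (induction "card A" arbitrary: A f rule: less_induct)
  case less
  let ?U = "A - {x}" and ?Z = "unused f (V - (A - {x}))"
  have finA: "finite A" using less.prems(2) fin by (auto intro: finite_subset)
  show ?case
  proof (rule Alice)
    fix v c' assume v: "v \<in> A" and ok: "ok f v c'"
    \<comment> \<open>All colours are in use, so the centre has no legal colour and Alice must
      choose a leaf. If no leaf is available, the rule \<open>Alice\<close> has nothing left to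
      prove.\<close>
    from ok less.prems(4) have "v \<noteq> x" by (auto simp: ok_center)
    with v less.prems have vL: "v \<in> L" and vU: "v \<in> ?U" by auto
    from ok vL have c': "c' \<in> {1..k}" "f v \<noteq> Some c'" "f x \<noteq> Some c'"
      by (auto simp: ok_leaf)
    let ?f = "f(v \<mapsto> c')"
    have rest1: "rest A v = A - {v}" using less.prems \<open>v \<noteq> x\<close> by (intro rest_eq[of x]) auto
    show "wins False (rest A v) ?f"
    proof (cases "unused ?f V = {}")
      case True
      with less.prems \<open>v \<noteq> x\<close> rest1 show ?thesis by (intro center_blocked) auto
    next
      case False
      \<comment> \<open>A colour can vanish only if \<open>v\<close> carried its last copy; hence
        exactly one colour \<open>c\<close> is lost.\<close>
      have only: "f v = Some y" if "y \<in> unused ?f V" for y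
        proof (rule ccontr)
        assume neg: "\<not> ?thesis"
        from that less.prems(4) have "Some y \<in> f ` V" by (auto simp: unused_def)
        then obtain u where u: "u \<in> V" "f u = Some y" by (metis imageE)
        with neg have "?f u = Some y" by auto
        with u(1) have "Some y \<in> ?f ` V" by (metis imageI)
        with that show False by (simp add: unused_def)
      qed
      from False obtain c where c: "c \<in> unused ?f V" by auto
      have fv: "f v = Some c" using only c by blast
      have "y = c" if "y \<in> unused ?f V" for y using only[OF that] fv by simp
      with c have unused1: "unused ?f V = {c}" by blast
      have cc': "c \<noteq> c'" using c' fv by auto
      have cZ: "c \<in> ?Z" using c vU by (auto simp: unused_def)
      \<comment> \<open>At the start of a round only the centre is settled, and \<open>c'\<close>
        differs from its colour. This is the second colour used up by the first exchange.\<close>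
      have c'Z: "c' \<in> ?Z" if "L \<subseteq> A"
        using that c' \<open>v \<noteq> x\<close> by (auto simp: unused_def)
      have card_U: "card (?U - {v}) = card ?U - 1" "card ?U \<ge> 1"
        using vU finA by (auto simp: card_gt_0_iff Suc_le_eq)
      \<comment> \<open>Otherwise the available leaves other than \<open>v\<close> carry pairwise
        different colours, none occurring elsewhere, so all of them lie in
        \<open>?Z - {c, c'}\<close>. By the hypothesis on cardinalities that set is too
        small.\<close>
      have "\<exists>w \<in> ?U - {v}. ?f w \<in> ?f ` (V - {w})"
      proof (rule ccontr)
        assume neg: "\<not> ?thesis"
        have sub: "f ` (?U - {v}) \<subseteq> Some ` (?Z - {c, c'})"
        proof
          fix y' assume "y' \<in> f ` (?U - {v})"
          then obtain w where w: "w \<in> ?U - {v}" "y' = f w" by auto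
          with less.prems have "w \<in> L" by auto
          then obtain y where y: "y \<in> {1..k}" "f w = Some y"
            using less.prems(3) by blast
          have nw: "Some y \<notin> ?f ` (V - {w})" using neg w y by fastforce
          have "y \<noteq> c'" using nw vL w by fastforce
          moreover have "y \<noteq> c" using c y w \<open>w \<in> L\<close> by (auto simp: unused_iff)
          moreover have "y \<in> ?Z"
          proof -
            have "f u \<noteq> Some y" if u: "u \<in> V - ?U" for u
            proof
              assume "f u = Some y"
              moreover have "u \<noteq> v" "u \<noteq> w" using u vU w by auto
              ultimately have "Some y \<in> ?f ` (V - {w})"
                using u by (intro image_eqI[of _ _ u]) auto
              with nw show False ..
            qed
            with y show ?thesis by (simp add: unused_iff)
          qed
          ultimately show "y' \<in> Some ` (?Z - {c, c'})" using w y by auto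
        qed
        have "inj_on f (?U - {v})"
        proof (rule inj_onI)
          fix a b assume ab: "a \<in> ?U - {v}" "b \<in> ?U - {v}" "f a = f b"
          show "a = b"
          proof (rule ccontr)
            assume "a \<noteq> b"
            then have "?f a \<in> ?f ` (V - {a})"
              using ab less.prems(2) by (intro image_eqI[of _ _ b]) auto
            with neg ab show False by blast
          qed
        qed
        then have "card (?U - {v}) \<le> card (Some ` (?Z - {c, c'}))"
          using sub by (metis card_image card_mono finite_Diff finite_imageI finite_unused)
        then have le: "card ?U - 1 \<le> card (?Z - {c, c'})"
          using card_U by (simp add: card_image)
        show False
        proof (cases "L \<subseteq> A")
          case True
          then have "card (?Z - {c, c'}) = card ?Z - 2" "card ?Z \<ge> 2"
            using cZ c'Z cc' card_mono[of ?Z "{c, c'}"] by (auto simp: card_Diff_subset)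
          with le less.prems(5) True card_U show False by simp
        next
          case False
          have "card (?Z - {c, c'}) \<le> card (?Z - {c})" by (rule card_mono) auto
          then have "card (?Z - {c, c'}) \<le> card ?Z - 1" using cZ by simp
          moreover have "card ?Z \<ge> 1" using cZ by (auto simp: card_gt_0_iff Suc_le_eq)
          ultimately show False using le less.prems(5) False card_U by simp
        qed
      qed
      then obtain w where w: "w \<in> ?U" "w \<noteq> v" "?f w \<in> ?f ` (V - {w})" by auto
      have wL: "w \<in> L" using w less.prems by auto
      let ?g = "?f(w \<mapsto> c)"
      have rest2: "rest (A - {v}) w = A - {v} - {w}"
        using less.prems \<open>v \<noteq> x\<close> w by (intro rest_eq[of x]) auto
      show ?thesis
      proof (rule Bob[where v = w and c = c])
        show "w \<in> rest A v" using rest1 w by auto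
        show "ok ?f w c" using wL c by (auto simp: ok_leaf unused_iff)
        \<comment> \<open>Giving \<open>c\<close> to \<open>w\<close> restores the lost colour, and
          the old colour of \<open>w\<close> survives on another vertex.\<close>
        have "unused ?g V = {}"
        proof -
          have "Some y \<in> ?g ` V" if y: "y \<in> {1..k}" for y
          proof (cases "y = c")
            case True
            then show ?thesis using wL by (intro image_eqI[of _ _ w]) auto
          next
            case False
            then have "y \<notin> unused ?f V" using unused1 by simp
            with y have "Some y \<in> ?f ` V" by (simp add: unused_def)
            then obtain u where u: "u \<in> V" "?f u = Some y" by (metis imageE)
            then obtain u' where "u' \<in> V - {w}" "?f u' = Some y"
            proof (cases "u = w")
              case True
              then show ?thesis using w(3) u that by (metis imageE)
            qed (use u that in auto)
            then show ?thesis by (intro image_eqI[of _ _ u']) auto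
          qed
          then show ?thesis by (auto simp: unused_def)
        qed
        moreover have "2 * card (unused ?g (V - (A - {v} - {w} - {x})))
           \<le> card (A - {v} - {w} - {x}) + (if L \<subseteq> A - {v} - {w} then 2 else 0)"
        proof -
          have "unused ?g (V - (A - {v} - {w} - {x})) \<subseteq> ?Z - {c, c'}"
          proof
            fix y assume y: "y \<in> unused ?g (V - (A - {v} - {w} - {x}))"
            have g: "?g u \<noteq> Some y" if "u \<in> V" "u = v \<or> u = w \<or> u \<notin> ?U" for u
              using y that by (auto simp: unused_iff simp del: fun_upd_apply)
            have "y \<noteq> c" using g[of w] wL by auto
            moreover have "y \<noteq> c'" using g[of v] vL w(2) by auto
            moreover have "f u \<noteq> Some y" if "u \<in> V - ?U" for u
              using g[of u] that vU w(1) by (cases "u = v"; cases "u = w") auto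
            then have "y \<in> ?Z" using y by (simp add: unused_iff)
            ultimately show "y \<in> ?Z - {c, c'}" by auto
          qed
          then have le: "card (unused ?g (V - (A - {v} - {w} - {x}))) \<le> card (?Z - {c, c'})"
            by (intro card_mono) auto
          have "A - {v} - {w} - {x} = ?U - {v} - {w}" by auto
          then have cU: "card (A - {v} - {w} - {x}) = card ?U - 2"
            using vU w finA by simp
          show ?thesis
          proof (cases "L \<subseteq> A")
            case True
            then have "card (?Z - {c, c'}) = card ?Z - 2"
              using cZ c'Z cc' by (auto simp: card_Diff_subset)
            with le less.prems(5) True cU show ?thesis by simp
          next
            case False
            have "card (?Z - {c, c'}) \<le> card (?Z - {c})" by (rule card_mono) auto
            then have "card (?Z - {c, c'}) \<le> card ?Z - 1" using cZ by simp
            with le less.prems(5) False cU show ?thesis by simp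
          qed
        qed
        moreover have "card (A - {v} - {w}) < card A"
          using v finA by (intro psubset_card_mono) auto
        moreover have "?g ` L \<subseteq> Some ` {1..k}"
          using less.prems(3) c c' by (auto simp: unused_def)
        ultimately show "wins True (rest (rest A v) w) ?g"
          unfolding rest1 rest2 using less.prems w \<open>v \<noteq> x\<close>
          by (intro less.hyps) auto
      qed
    qed
  qed
qed

text \<open>Here only the centre is settled, so \<open>k - 1\<close> colours are still to be
  secured; with the bonus, the condition of \<open>wins_all_colours\<close> becomes
  \<open>2 * (k - 1) \<le> card L + 2\<close>.\<close>

lemma wins_round_start:
  assumes "f x = Some d" "d \<in> {1..k}" "f ` L \<subseteq> Some ` {1..k}" "unused f V = {}"
    and "2 * k \<le> card L + 4"
  shows "wins True V f"
proof (rule wins_all_colours)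
  have "unused f (V - (V - {x})) = {1..k} - {d}"
  proof -
    have "V - (V - {x}) = {x}" by auto
    with assms(1) show ?thesis by (auto simp: unused_def)
  qed
  moreover have "V - {x} = L" using center by auto
  ultimately show "2 * card (unused f (V - (V - {x})))
      \<le> card (V - {x}) + (if L \<subseteq> V then 2 else 0)"
    using assms(2,5) by auto
qed (use assms in auto)

section \<open>Completing a round with all colours in use\<close>

text \<open>
  Bob completes the round so that every colour is used when the next one starts.  He gets stuck only
  if all available leaves carry the very colour he still has to place, so he places the most
  frequent colour \<open>z0\<close> first, if possible on a leaf that carries another colour still to be placed.
\<close>

lemma wins_fill:
  assumes "card A = 2 * j + 1" "A \<subseteq> L" "f x = Some d" "d \<in> {1..k}"
    and "f ` L \<subseteq> Some ` {1..k}" "3 \<le> k" "2 * k \<le> card L + 4"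
    and "card (unused f (V - A)) \<le> Suc j"
    and "\<And>z. z \<in> unused f (V - A) \<Longrightarrow> \<exists>v \<in> A. f v \<noteq> Some z"
  shows "wins False A f"
  using assms
proof (induction j arbitrary: A f)
  case 0
  let ?Z = "unused f (V - A)"
  obtain w where A: "A = {w}"
    using 0(1) by (auto simp: card_1_singleton_iff)
  have wL: "w \<in> L" using A 0(2) by simp
  \<comment> \<open>At most one colour is missing and, by the last hypothesis, the only available
    leaf \<open>w\<close> does not carry it already, so Bob may put it there.\<close>
  have "\<exists>c. ok f w c \<and> ?Z \<subseteq> {c}"
  proof (cases "?Z = {}")
    case True
    then show ?thesis using ex_ok_leaf[OF 0(6) wL] by auto
  next
    case False
    then obtain z where z: "z \<in> ?Z" by auto
    have "?Z = {z}"
      using 0(8) z card_le_Suc0_iff_eq[of ?Z] by auto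
    moreover have "ok f w z"
      using z 0(9)[OF z] wL A center by (auto simp: ok_leaf unused_iff)
    ultimately show ?thesis by auto
  qed
  then obtain c where c: "ok f w c" "?Z \<subseteq> {c}" by auto
  have sub: "unused (f(w \<mapsto> c)) V = {}"
  proof -
    have False if y: "y \<in> unused (f(w \<mapsto> c)) V" for y
    proof -
      have "y \<noteq> c" using y wL by (auto simp: unused_def)
      moreover have "y \<in> ?Z" using y A by (force simp: unused_def)
      ultimately show False using c by auto
    qed
    then show ?thesis by auto
  qed
  show ?case
  proof (rule Bob[where v = w, OF _ c(1)])
    show "w \<in> A" using A by simp
    show "wins True (rest A w) (f(w \<mapsto> c))"
      unfolding A rest_singleton using 0 c wL center sub
      by (intro wins_round_start[of _ d]) (auto simp: ok_leaf)
  qed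
next
  case (Suc j)
  let ?Z = "unused f (V - A)"
  let ?N = "\<lambda>z. {u \<in> A. f u = Some z}"
  have finA: "finite A" using Suc.prems(2) fin by (rule finite_subset)
  \<comment> \<open>Two colours share the \<open>2 * j + 3\<close> leaves of \<open>A\<close>, so
    one of them occurs on at most \<open>j + 1\<close>.\<close>
  have card_N: "card (?N z) + card (?N z') \<le> 2 * j + 3" if "z \<noteq> z'" for z z'
  proof -
    have "card (?N z) + card (?N z') = card (?N z \<union> ?N z')"
      using that finA by (intro card_Un_disjoint[symmetric]) auto
    also have "\<dots> \<le> card A" using finA by (intro card_mono) auto
    finally show ?thesis using Suc.prems(1) by simp
  qed
  \<comment> \<open>After Alice's reply \<open>2 * j + 1\<close> leaves remain. The bound
    \<open>2 * j\<close> prevents them from all carrying one missing colour, which keeps the last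
    hypothesis alive for the induction.\<close>
  have "\<exists>w \<in> A. \<exists>c. ok f w c \<and> card (?Z - {c}) \<le> Suc j
      \<and> (\<forall>z \<in> ?Z - {c}. card (?N z - {w}) \<le> 2 * j)"
  proof (cases "?Z = {}")
    case True
    have "A \<noteq> {}" using Suc.prems(1) by auto
    then obtain w where w: "w \<in> A" by auto
    have "\<exists>c. ok f w c" using ex_ok_leaf[OF Suc.prems(6)] w Suc.prems(2) by auto
    with True w show ?thesis by auto
  next
    case False
    then have "Max ((\<lambda>z. card (?N z)) ` ?Z) \<in> (\<lambda>z. card (?N z)) ` ?Z"
      by (intro Max_in) auto
    then obtain z0 where z0: "z0 \<in> ?Z" and eq: "Max ((\<lambda>z. card (?N z)) ` ?Z) = card (?N z0)"
      by (rule imageE)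
    have max: "card (?N z) \<le> card (?N z0)" if "z \<in> ?Z" for z
      unfolding eq[symmetric] using that by (intro Max_ge) auto
    obtain w where w: "w \<in> A" "f w \<noteq> Some z0"
      and pref: "(\<exists>u \<in> A. f u \<in> Some ` (?Z - {z0})) \<Longrightarrow> f w \<in> Some ` (?Z - {z0})"
    proof (cases "\<exists>u \<in> A. f u \<in> Some ` (?Z - {z0})")
      case True
      then show ?thesis using that by fastforce
    next
      case False
      then show ?thesis using that Suc.prems(9)[OF z0] by blast
    qed
    have "w \<in> L" "x \<in> V - A" using w Suc.prems(2) center by auto
    with z0 w have ok: "ok f w z0" by (auto simp: ok_leaf unused_iff)
    have "card (?N z - {w}) \<le> 2 * j" if z: "z \<in> ?Z - {z0}" for z
    proof -
      have le: "card (?N z) \<le> Suc j" using card_N[of z z0] max[of z] z by auto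
      show ?thesis
      \<comment> \<open>By \<open>le\<close> there are at most \<open>j + 1\<close> such leaves,
        which is within \<open>2 * j\<close> unless \<open>j = 0\<close>. In that case
        \<open>z\<close> is the only missing colour besides \<open>z0\<close>, and by
        \<open>pref\<close> Bob has chosen the one leaf that carries it.\<close>
      proof (cases "j = 0 \<and> ?N z \<noteq> {}")
        case True
        then obtain u where "u \<in> A" "f u = Some z" by auto
        with pref z have "f w \<in> Some ` (?Z - {z0})" by blast
        moreover have "?Z - {z0} = {z}"
        proof -
          have "card (?Z - {z0}) \<le> Suc 0" using Suc.prems(8) True z0 by simp
          with z show ?thesis using card_le_Suc0_iff_eq[of "?Z - {z0}"] by auto
        qed
        ultimately have "w \<in> ?N z" using w by auto
        then have "card (?N z - {w}) = card (?N z) - 1" by simp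
        with le True show ?thesis by simp
      next
        case False
        moreover have "card (?N z - {w}) \<le> card (?N z)"
          using finA by (intro card_mono) auto
        moreover have "?N z - {w} = {}" if "?N z = {}" using that by blast
        ultimately show ?thesis using le by (cases "j = 0") (simp_all del: Collect_empty_eq)
      qed
    qed
    moreover have "card (?Z - {z0}) \<le> Suc j" using z0 Suc.prems(8) by simp
    ultimately show ?thesis using w ok by blast
  qed
  then obtain w c where w: "w \<in> A" and c: "ok f w c" "card (?Z - {c}) \<le> Suc j"
    and few: "\<And>z. z \<in> ?Z - {c} \<Longrightarrow> card (?N z - {w}) \<le> 2 * j"
    by blast
  have wL: "w \<in> L" using w Suc.prems(2) by auto
  have card_w: "card (A - {w}) = 2 * j + 2" using w Suc.prems(1) by simp
  have "A - {w} \<noteq> {}" using card_w by (metis card.empty add_2_eq_Suc' nat.distinct(1))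
  then have rest1: "rest A w = A - {w}" by (auto simp: remaining_def)
  show ?case
  proof (rule Bob[where v = w, OF w c(1)], rule Alice)
    fix v c' assume "v \<in> rest A w" and ok': "ok (f(w \<mapsto> c)) v c'"
    then have v: "v \<in> A - {w}" using rest1 by simp
    then have vL: "v \<in> L" using Suc.prems(2) by auto
    let ?g = "f(w \<mapsto> c, v \<mapsto> c')"
    let ?B = "A - {w} - {v}"
    have card_B: "card ?B = 2 * j + 1" using v card_w by simp
    have "?B \<noteq> {}"
    proof
      assume "?B = {}"
      then have "card ?B = 0" by (simp only: card.empty)
      with card_B show False by simp
    qed
    then have rest2: "rest (A - {w}) v = ?B" by (auto simp: remaining_def)
    \<comment> \<open>The old colours of \<open>v\<close> and \<open>w\<close> were not counted as
      secured, so the exchange can only shrink the set of missing colours.\<close>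
    have sub: "unused ?g (V - ?B) \<subseteq> ?Z - {c}"
    proof
      fix y assume y: "y \<in> unused ?g (V - ?B)"
      have g: "?g u \<noteq> Some y" if "u \<in> V" "u = v \<or> u = w \<or> u \<notin> A" for u
        using y that by (auto simp: unused_iff simp del: fun_upd_apply)
      have "y \<noteq> c" using g[of w] wL v by auto
      moreover have "f u \<noteq> Some y" if "u \<in> V - A" for u
        using g[of u] that v w by (cases "u = v"; cases "u = w") auto
      then have "y \<in> ?Z" using y by (simp add: unused_iff)
      ultimately show "y \<in> ?Z - {c}" by blast
    qed
    show "wins False (rest (rest A w) v) ?g"
      unfolding rest1 rest2
    proof (rule Suc.IH[OF card_B])
      show "?B \<subseteq> L" using Suc.prems(2) by auto
      show "?g x = Some d" using Suc.prems(3) wL vL center by auto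
      show "?g ` L \<subseteq> Some ` {1..k}"
        using Suc.prems(5) c ok' wL vL by (auto simp: ok_leaf)
      show "card (unused ?g (V - ?B)) \<le> Suc j"
        using card_mono[OF _ sub] c(2) by simp
      show "\<exists>u \<in> ?B. ?g u \<noteq> Some z" if z: "z \<in> unused ?g (V - ?B)" for z
      proof (rule ccontr)
        assume "\<not> ?thesis"
        then have "?B \<subseteq> ?N z - {w}" by auto
        then have "card ?B \<le> card (?N z - {w})" using finA by (intro card_mono) auto
        with few[of z] card_B sub z show False by auto
      qed
    qed (use Suc.prems in auto)
  qed
qed

section \<open>Second round for an even number of leaves\<close>

lemma wins_even_round_start:
  assumes "f x = Some d" "d \<in> {1..k}" "f ` L \<subseteq> Some ` {1..k}"
    and "even (card L)" "4 \<le> card L" "k \<le> card L div 2 + 2"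
    and "card (unused f V) \<le> k - 1 - card L div 2"
  shows "wins False V f"
proof (cases "unused f V = {}")
  case True
  then show ?thesis by (intro center_blocked) auto
next
  case False
  then have pos: "card (unused f V) > 0" by (simp add: card_gt_0_iff)
  with assms(6,7) have k: "k = card L div 2 + 2" and "card (unused f V) = 1" by auto
  then obtain c0 where c0: "unused f V = {c0}" by (auto simp: card_1_singleton_iff)
  have c0k: "c0 \<in> {1..k}" "c0 \<noteq> d"
    using c0 assms(1) by (auto simp: unused_def)
  have k_bounds: "3 \<le> k" "2 * k \<le> card L + 4" using k assms(4,5) by auto
  show ?thesis
  proof (cases "\<exists>v \<in> L. \<exists>a. \<forall>u \<in> L - {v}. f u = Some a")
    case True
    then obtain v a where v: "v \<in> L" and a: "\<And>u. u \<in> L - {v} \<Longrightarrow> f u = Some a" by auto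
    obtain b where b: "f v = Some b" using assms(3) v by blast
    \<comment> \<open>If all leaves but one agree, these are the only colours. Since
      \<open>k = card L div 2 + 2\<close> is at least 4, there are four leaves and the four colours
      are distinct.\<close>
    have "{1..k} \<subseteq> {c0, d, a, b}"
    proof
      fix y assume y: "y \<in> {1..k}"
      show "y \<in> {c0, d, a, b}"
      proof (rule ccontr)
        assume neg: "y \<notin> {c0, d, a, b}"
        then have "Some y \<in> f ` V" using c0 y by (auto simp: unused_def)
        then obtain u where "u \<in> V" "f u = Some y" by (metis imageE)
        with neg a b assms(1) show False by (cases "u = x"; cases "u = v") auto
      qed
    qed
    then have le: "k \<le> card {c0, d, a, b}" using card_mono[of "{c0, d, a, b}" "{1..k}"] by simp
    moreover have "card {c0, d, a, b} \<le> 4" by (simp add: card_insert_if)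
    ultimately have k4: "k = 4" and L4: "card L = 4" using k assms(4,5) by auto
    have dist: "a \<noteq> b" "a \<noteq> d" using le k4 by (auto simp: card_insert_if split: if_splits)
    have cardLv: "card (L - {v}) = 3" using L4 v by simp
    then obtain u0 where "u0 \<in> L - {v}" by (metis card.empty ex_in_conv zero_neq_numeral)
    with a assms(3) have ak: "a \<in> {1..k}" by force
    \<comment> \<open>Now all leaves carry \<open>a\<close>, which is secured on \<open>v\<close>
      for this round.\<close>
    let ?f1 = "f(v \<mapsto> a)"
    have f1: "?f1 u = Some a" if "u \<in> L" for u using a that by auto
    have vx: "v \<noteq> x" using v center by auto
    have rest1: "rest V v = V - {v}" using vx by (intro rest_eq[of x]) auto
    show ?thesis
    proof (rule Bob[where v = v and c = a])
      show "v \<in> V" "ok f v a" using v b dist ak assms(1) by (auto simp: ok_leaf)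
      show "wins True (rest V v) ?f1"
      proof (rule Alice)
        fix u c assume "u \<in> rest V v" and ok: "ok ?f1 u c"
        then have u: "u \<in> V" "u \<noteq> v" using rest1 by auto
        show "wins False (rest (rest V v) u) (?f1(u \<mapsto> c))"
        proof (cases "u = x")
          \<comment> \<open>Alice recolours the centre. At most two colours are missing, and the
            three available leaves carry \<open>a\<close>, which is not missing, so
            \<open>wins_fill\<close> applies with \<open>j = 1\<close>.\<close>
          case True
          let ?g = "?f1(x \<mapsto> c)"
          have c: "c \<in> {1..k}" "c \<noteq> a"
            using ok True f1[OF v] v by (auto simp: ok_center unused_iff)
          have "V - {v} - {x} = L - {v}" using center by auto
          moreover have "L - {v} \<noteq> {}" using \<open>u0 \<in> L - {v}\<close> by blast
          ultimately have rest2: "rest (V - {v}) x = L - {v}"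
            by (auto simp: remaining_def)
          have VL: "V - (L - {v}) = {x, v}" using v center by auto
          have "unused ?g (V - (L - {v})) \<subseteq> {1..k} - {c, a}"
            unfolding VL using vx by (auto simp: unused_iff)
          then have "card (unused ?g (V - (L - {v}))) \<le> card ({1..k} - {c, a})"
            by (intro card_mono) auto
          then have card_Z: "card (unused ?g (V - (L - {v}))) \<le> 2"
            using c ak k4 by (simp add: card_Diff_subset)
          show ?thesis
            unfolding True rest1 rest2
          proof (rule wins_fill[of _ 1])
            show "?g ` L \<subseteq> Some ` {1..k}" using f1 ak center by auto
            show "\<exists>u \<in> L - {v}. ?g u \<noteq> Some z" if "z \<in> unused ?g (V - (L - {v}))" for z
              using that \<open>u0 \<in> L - {v}\<close> center a vx unfolding VL
              by (intro bexI[of _ u0]) (auto simp: unused_iff)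
          qed (use cardLv c k_bounds card_Z in auto)
        next
          case False
          with u have uL: "u \<in> L" by auto
          have c: "c \<in> {1..k}" "c \<noteq> a" "c \<noteq> d"
            using ok uL f1 assms(1) vx by (auto simp: ok_leaf)
          \<comment> \<open>Alice recolours a leaf. Of the four colours only \<open>e\<close> is
            then missing; Bob puts it on a third leaf, and all leaf colours are secured while the
            centre is still available.\<close>
          have "card ({1..k} - {a, c, d}) = 1"
            using k4 ak c assms(2) dist by (simp add: card_Diff_subset)
          then obtain e where e: "{1..k} - {a, c, d} = {e}" by (auto simp: card_1_singleton_iff)
          then have ek: "e \<in> {1..k}" "e \<noteq> a" "e \<noteq> c" "e \<noteq> d" by blast+
          have "card (L - {v} - {u}) = 2" using cardLv u uL by simp
          then obtain w where w: "w \<in> L" "w \<noteq> v" "w \<noteq> u"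
            by (metis DiffE card.empty ex_in_conv insertCI zero_neq_numeral)
          have rest2: "rest (V - {v}) u = V - {v} - {u}"
            using vx False by (intro rest_eq[of x]) auto
          have wx: "w \<noteq> x" using w center by auto
          have rest3: "rest (V - {v} - {u}) w = V - {v} - {u} - {w}"
            using vx False wx by (intro rest_eq[of x]) auto
          let ?g = "?f1(u \<mapsto> c, w \<mapsto> e)"
          have used: "unused ?g S = {}" if "{x, v, u, w} \<subseteq> S" for S
          proof -
            have g: "?g x = Some d" "?g v = Some a" "?g u = Some c" "?g w = Some e"
              using assms(1) vx False wx w u by auto
            have False if "z \<in> unused ?g S" for z
            proof -
              have z: "z \<in> {1..k}" and neq: "?g s \<noteq> Some z" if "s \<in> S" for s
                using \<open>z \<in> unused ?g S\<close> that by (simp_all only: unused_iff) blast+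
              have "x \<in> S" "v \<in> S" "u \<in> S" "w \<in> S" using \<open>{x, v, u, w} \<subseteq> S\<close> by auto
              from this[THEN neq] have "z \<noteq> d" "z \<noteq> a" "z \<noteq> c" "z \<noteq> e"
                unfolding g by auto
              with z[OF \<open>x \<in> S\<close>] e show False by blast
            qed
            then show ?thesis by blast
          qed
          show ?thesis
            unfolding rest1 rest2
          proof (rule Bob[where v = w and c = e])
            show "w \<in> V - {v} - {u}" using w by auto
            show "ok (?f1(u \<mapsto> c)) w e"
              using ek w assms(1) vx False f1[OF w(1)] by (auto simp: ok_leaf)
            show "wins True (rest (V - {v} - {u}) w) ?g"
              unfolding rest3
            proof (rule wins_all_colours)
              show "?g ` L \<subseteq> Some ` {1..k}" using f1 ak c ek by auto
              show "unused ?g V = {}" using v uL w by (intro used) auto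
              have "unused ?g (V - (V - {v} - {u} - {w} - {x})) = {}"
                using v uL w by (intro used) auto
              then show "2 * card (unused ?g (V - (V - {v} - {u} - {w} - {x})))
                \<le> card (V - {v} - {u} - {w} - {x}) + (if L \<subseteq> V - {v} - {u} - {w} then 2 else 0)"
                by simp
            qed (use vx False wx in auto)
          qed
        qed
      qed
    qed
  next
    case False
    have "L \<noteq> {}" using assms(5) by auto
    then have rest1: "rest V x = L"
      using center by (auto simp: remaining_def)
    show ?thesis
    proof (rule Bob[where v = x and c = c0])
      show "ok f x c0" using c0 by (simp add: ok_center)
      show "wins True (rest V x) (f(x \<mapsto> c0))"
        unfolding rest1
      proof (rule Alice)
        fix v c assume v: "v \<in> L" and ok: "ok (f(x \<mapsto> c0)) v c"
        let ?g = "f(x \<mapsto> c0, v \<mapsto> c)"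
        have vx: "v \<noteq> x" using v center by auto
        have c: "c \<in> {1..k}" "c \<noteq> c0" using ok v by (auto simp: ok_leaf)
        \<comment> \<open>This fits \<open>wins_fill\<close> with
          \<open>j = card L div 2 - 1\<close>: only \<open>c0\<close> and \<open>c\<close> are
          secured, so \<open>k - 2 = Suc j\<close> colours are missing. Its last hypothesis is the
          case assumption that no \<open>card L - 1\<close> leaves agree.\<close>
        have cardLv: "card (L - {v}) = 2 * (card L div 2 - 1) + 1"
          using v assms(4,5) by auto
        have "L - {v} \<noteq> {}"
        proof
          assume "L - {v} = {}"
          then have "card (L - {v}) = 0" by (simp only: card.empty)
          with cardLv show False by simp
        qed
        then have rest2: "rest L v = L - {v}" by (auto simp: remaining_def)
        have VL: "V - (L - {v}) = {x, v}" using v center by auto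
        have "unused ?g (V - (L - {v})) \<subseteq> {1..k} - {c0, c}"
          unfolding VL using vx by (auto simp: unused_iff)
        then have "card (unused ?g (V - (L - {v}))) \<le> card ({1..k} - {c0, c})"
          by (intro card_mono) auto
        also have "\<dots> = Suc (card L div 2 - 1)"
          using c c0k k assms(5) by (simp add: card_Diff_subset)
        finally have card_Z: "card (unused ?g (V - (L - {v}))) \<le> Suc (card L div 2 - 1)" .
        show "wins False (rest L v) ?g"
          unfolding rest2
        proof (rule wins_fill[OF cardLv])
          show "?g ` L \<subseteq> Some ` {1..k}" using assms(3) c center by auto
          show "\<exists>u \<in> L - {v}. ?g u \<noteq> Some z" for z
            using False v center by fastforce
        qed (use vx c0k k_bounds card_Z in auto)
      qed
    qed simp
  qed
qed

section \<open>The first round\<close>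

lemma unused_upd:
  assumes "f v = None" "v \<in> S"
  shows "unused (f(v \<mapsto> c)) S = unused f S - {c}"
proof -
  have "(\<forall>u \<in> S. (f(v \<mapsto> c)) u \<noteq> Some y) \<longleftrightarrow> y \<noteq> c \<and> (\<forall>u \<in> S. f u \<noteq> Some y)" for y
    using assms by (metis fun_upd_other fun_upd_same option.distinct(1) option.inject)
  then show ?thesis by (auto simp: unused_iff simp del: fun_upd_apply)
qed

text \<open>
  \<open>wins (odd (card L)) V f\<close> is the start of the second round: the first one consists of
  \<open>card L + 1\<close> moves.
\<close>

context
  fixes e :: nat
  assumes wins_second_round: "\<And>f d. \<lbrakk>f x = Some d; d \<in> {1..k}; f ` L \<subseteq> Some ` {1..k};
      card (unused f V) \<le> e\<rbrakk> \<Longrightarrow> wins (odd (card L)) V f"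
begin

lemma wins_first_round_leaves:
  assumes "A \<subseteq> L" "f x = Some d" "d \<in> {1..k}" "f ` (L - A) \<subseteq> Some ` {1..k}"
    and "\<And>v. v \<in> A \<Longrightarrow> f v = None" "even (card A) \<longleftrightarrow> even (card L)"
    and "card (unused f V) \<le> (card A + 1) div 2 + e"
  shows "wins False (if A = {} then V else A) f"
  using assms
proof (induction "card A" arbitrary: A f rule: less_induct)
  case less
  have finA: "finite A" using less.prems(1) fin by (rule finite_subset)
  show ?case
  proof (cases "A = {}")
    case True
    with less.prems wins_second_round[of f d] show ?thesis by simp
  next
    case False
    then obtain w where w: "w \<in> A" by auto
    then have wL: "w \<in> L" and fw: "f w = None" and wx: "w \<noteq> x"
      using less.prems center by auto
    show ?thesis
    proof (cases "\<exists>c. ok f w c")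
      \<comment> \<open>This occurs only for \<open>k = 1\<close>; Bob chooses the blocked
        leaf.\<close>
      case no: False
      with False w show ?thesis by (auto intro: blocked)
    next
      case True
      \<comment> \<open>If every colour is in use, any legal colour serves, since the truncated
        subtraction \<open>0 - 1\<close> is 0.\<close>
      obtain c where c: "ok f w c" and less_unused: "card (unused f V - {c}) \<le> card (unused f V) - 1"
      proof (cases "unused f V = {}")
        case True
        with \<open>\<exists>c. ok f w c\<close> that show ?thesis by auto
      next
        case False
        then obtain c where "c \<in> unused f V" by auto
        moreover from this have "ok f w c"
          using wL fw by (auto simp: ok_leaf unused_iff)
        ultimately show ?thesis using that by simp
      qed
      have ck: "c \<in> {1..k}" using c wL by (simp add: ok_leaf)
      let ?f = "f(w \<mapsto> c)"
      have unused1: "unused ?f V = unused f V - {c}" using fw wL by (intro unused_upd) auto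
      have "wins True (rest A w) ?f"
      proof (cases "A = {w}")
        case True
        have "wins (odd (card L)) V ?f"
        proof (rule wins_second_round)
          show "?f x = Some d" using wx less.prems by simp
          show "?f ` L \<subseteq> Some ` {1..k}" using True less.prems(4) ck by auto
          show "card (unused ?f V) \<le> e"
            using unused1 less_unused less.prems(7) True by simp
        qed (use less.prems in auto)
        moreover have "odd (card L)" using less.prems(6) True by simp
        ultimately show ?thesis unfolding True rest_singleton by simp
      next
        case False
        then have rest1: "rest A w = A - {w}" using w by (auto simp: remaining_def)
        show ?thesis
          unfolding rest1
        proof (rule Alice)
          fix v c' assume v: "v \<in> A - {w}" and ok': "ok ?f v c'"
          let ?g = "?f(v \<mapsto> c')" and ?B = "A - {w} - {v}"
          have vL: "v \<in> L" and fv: "?f v = None" and vx: "v \<noteq> x"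
            using v less.prems center by auto
          have c'k: "c' \<in> {1..k}" using ok' vL by (simp add: ok_leaf)
          have rest2: "rest (A - {w}) v = (if ?B = {} then V else ?B)"
            using v by (auto simp: remaining_def verts_eq)
          have card_B: "card ?B = card A - 2" "card A \<ge> 2"
            using v w finA card_mono[of A "{v, w}"] by auto
          have "unused ?g V = unused f V - {c} - {c'}"
            using unused1 fv vL by (subst unused_upd) auto
          moreover have "card (unused f V - {c} - {c'}) \<le> card (unused f V - {c})"
            by (rule card_mono) auto
          ultimately have card_unused: "card (unused ?g V) \<le> card (unused f V) - 1"
            using less_unused by simp
          show "wins False (rest (A - {w}) v) ?g"
            unfolding rest2
          proof (rule less.hyps)
            show "card ?B < card A" using card_B by simp
            show "?g ` (L - ?B) \<subseteq> Some ` {1..k}" using less.prems(4) ck c'k by auto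
            show "even (card ?B) \<longleftrightarrow> even (card L)" using card_B less.prems(6) by simp
            show "card (unused ?g V) \<le> (card ?B + 1) div 2 + e"
              using card_unused card_B less.prems(7) by simp
          qed (use less.prems vx wx in auto)
        qed
      qed
      with False w c show ?thesis by (auto intro: Bob)
    qed
  qed
qed

text \<open>As long as the centre is uncoloured, a first move of Alice on a leaf wastes a colour;
  hence the bonus 1 before any leaf is coloured.\<close>

lemma wins_first_round:
  assumes "A \<subseteq> V" "x \<in> A" "f ` (V - A) \<subseteq> Some ` {1..k}"
    and "\<And>v. v \<in> A \<Longrightarrow> f v = None" "even (card (A - {x})) \<longleftrightarrow> even (card L)"
    and "card (unused f V) \<le> (card (A - {x}) + 1) div 2 + e + (if L \<subseteq> A then 1 else 0)"
  shows "wins True A f"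
  using assms
proof (induction "card A" arbitrary: A f rule: less_induct)
  case less
  let ?U = "A - {x}"
  have finA: "finite A" using less.prems(1) fin by (auto intro: finite_subset)
  show ?case
  proof (rule Alice)
    fix v c assume v: "v \<in> A" and ok: "ok f v c"
    let ?f = "f(v \<mapsto> c)"
    have ck: "c \<in> {1..k}" using ok by (simp add: colour_ok_def)
    have unused1: "unused ?f V = unused f V - {c}"
      using less.prems v by (intro unused_upd) auto
    show "wins False (rest A v) ?f"
    proof (cases "v = x")
      case True
      have rest1: "rest A x = (if ?U = {} then V else ?U)"
        by (auto simp: remaining_def verts_eq)
      have "c \<in> unused f V" using ok True by (simp add: ok_center)
      then have "card (unused ?f V) = card (unused f V) - 1" using unused1 by simp
      then have card1: "card (unused ?f V) \<le> (card ?U + 1) div 2 + e"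
        using less.prems(6) by (auto split: if_splits)
      show ?thesis
        unfolding True rest1
      proof (rule wins_first_round_leaves)
        have "L - ?U \<subseteq> V - A" using center by auto
        then show "(f(x \<mapsto> c)) ` (L - ?U) \<subseteq> Some ` {1..k}"
          using less.prems(3) center by fastforce
        show "card (unused (f(x \<mapsto> c)) V) \<le> (card ?U + 1) div 2 + e"
          using card1 True by simp
      qed (use less.prems ck in auto)
    next
      case False
      then have vL: "v \<in> L" and vU: "v \<in> ?U" using v less.prems by auto
      have rest1: "rest A v = A - {v}" using less.prems False by (intro rest_eq[of x]) auto
      show ?thesis
      proof (cases "unused ?f V = {}")
        case True
        then show ?thesis unfolding rest1 using False less.prems by (intro center_blocked) auto
      next
        case nonempty: False
        then obtain y where y: "y \<in> unused ?f V" by auto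
        have yk: "y \<in> {1..k}" using y by (simp add: unused_def)
        \<comment> \<open>Before anything is coloured, Alice's \<open>c\<close> is new as well as
          Bob's \<open>y\<close>, so the exchange uses up two colours and the bonus; later it uses
          up at least one.\<close>
        have card_two: "card (unused ?f V - {y}) \<le> (card ?U + 1) div 2 + e - 1"
        proof (cases "L \<subseteq> A")
          case True
          have "c \<in> unused f V"
          proof -
            have "A = V" using True less.prems by auto
            with less.prems(4) ck show ?thesis by (auto simp: unused_def)
          qed
          then have "card (unused ?f V) = card (unused f V) - 1" using unused1 by simp
          with y True less.prems(6) show ?thesis by simp
        next
          case False
          have "card (unused ?f V) \<le> card (unused f V)"
            unfolding unused1 by (rule card_mono) auto
          with y False less.prems(6) show ?thesis by simp
        qed
        show ?thesis
        \<comment> \<open>If only the centre is left, Bob must take it, and its colour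
          \<open>y\<close> is the new one that ends the round.\<close>
        proof (cases "A - {v} = {x}")
          case True
          then have U: "?U = {v}" using vU by auto
          have "wins (odd (card L)) V (?f(x \<mapsto> y))"
          proof (rule wins_second_round)
            show "(?f(x \<mapsto> y)) ` L \<subseteq> Some ` {1..k}"
            proof (rule image_subsetI)
              fix u assume u: "u \<in> L"
              show "(?f(x \<mapsto> y)) u \<in> Some ` {1..k}"
              proof (cases "u = v")
                case True
                then show ?thesis using ck \<open>v \<noteq> x\<close> by simp
              next
                case False
                have ux: "u \<noteq> x" using u center by auto
                have "u \<notin> A - {v}" unfolding \<open>A - {v} = {x}\<close> using ux by simp
                with False u have "u \<in> V - A" by simp
                with less.prems(3) False ux show ?thesis by auto
              qed
            qed
            have "unused (?f(x \<mapsto> y)) V = unused ?f V - {y}"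
              using less.prems False by (intro unused_upd) auto
            then show "card (unused (?f(x \<mapsto> y)) V) \<le> e"
              using card_two U by simp
          qed (use yk in auto)
          moreover have "odd (card L)" using less.prems(5) U by simp
          ultimately have "wins True (rest {x} x) (?f(x \<mapsto> y))"
            unfolding rest_singleton by simp
          then show ?thesis
            unfolding rest1 True using y by (intro Bob[of x]) (auto simp: ok_center)
        next
          case more: False
          then obtain w where w: "w \<in> A" "w \<noteq> v" "w \<noteq> x" using False less.prems(2) by auto
          then have wL: "w \<in> L" and fw: "?f w = None" using less.prems by auto
          let ?g = "?f(w \<mapsto> y)" and ?B = "A - {v} - {w}"
          have rest2: "rest (A - {v}) w = ?B"
            using less.prems False w by (intro rest_eq[of x]) auto
          have "?B - {x} = ?U - {v} - {w}" by auto
          then have card_B: "card (?B - {x}) = card ?U - 2" "card ?U \<ge> 2"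
            using vU w finA card_mono[of ?U "{v, w}"] by auto
          have "wins True ?B ?g"
          proof (rule less.hyps)
            show "card ?B < card A" using v finA by (intro psubset_card_mono) auto
            show "?g ` (V - ?B) \<subseteq> Some ` {1..k}" using less.prems(3) ck yk by auto
            show "even (card (?B - {x})) \<longleftrightarrow> even (card L)" using card_B less.prems(5) by simp
            have "unused ?g V = unused ?f V - {y}" using fw wL by (intro unused_upd) auto
            then show "card (unused ?g V)
                \<le> (card (?B - {x}) + 1) div 2 + e + (if L \<subseteq> ?B then 1 else 0)"
              using card_two card_B by simp
          qed (use less.prems False w in auto)
          then show ?thesis
            unfolding rest1 using w y wL fw rest2
            by (intro Bob[of w _ _ _ _ y]) (auto simp: ok_leaf unused_iff)
        qed
      qed
    qed
  qed
qed

lemma wins_start: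
  assumes "k \<le> (card L + 1) div 2 + e + 1"
  shows "wins True (verts G) Map.empty"
proof -
  have "unused Map.empty V = {1..k}" by (auto simp: unused_def)
  moreover have "V - {x} = L" using center by auto
  ultimately show ?thesis
    unfolding verts_eq using assms by (intro wins_first_round) auto
qed

end

section \<open>The bounds for both parities\<close>

lemma wins_odd:
  assumes "odd (card L)" "k < (card L + 1) div 2 + 2"
  shows "wins True (verts G) Map.empty"
proof (rule wins_start[of 0])
  fix f d
  assume *: "f x = Some d" "d \<in> {1..k}" "f ` L \<subseteq> Some ` {1..k}" "card (unused f V) \<le> 0"
  have "2 * k \<le> card L + 4" using assms by auto
  with * assms(1) wins_round_start[of f d] show "wins (odd (card L)) V f" by simp
qed (use assms in auto)

lemma wins_even:
  assumes "even (card L)" "4 \<le> card L" "k < card L div 2 + 3"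
  shows "wins True (verts G) Map.empty"
\<comment> \<open>The subtraction is truncated: the tolerance is 1 for the largest \<open>k\<close>
  considered, \<open>card L div 2 + 2\<close>, and 0 for all smaller ones.\<close>
proof (rule wins_start[of "k - 1 - card L div 2"])
  fix f d
  assume "f x = Some d" "d \<in> {1..k}" "f ` L \<subseteq> Some ` {1..k}"
    and "card (unused f V) \<le> k - 1 - card L div 2"
  with assms wins_even_round_start[of f d] show "wins (odd (card L)) V f" by simp
qed (use assms in auto)

end

theorem theorem3p3:
  fixes G :: "('a, 'b) pre_digraph" and n :: nat
  assumes "n \<ge> 1"
    and "K\<^bsub>1,n\<^esub> G"
  shows "(odd n \<longrightarrow> int (eternal_game_chromatic_number G) \<ge> \<lceil>real n / 2\<rceil> + 2) \<and>
    (even n \<and> n \<ge> 4 \<longrightarrow> real (eternal_game_chromatic_number G) \<ge> real n / 2 + 3)"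
proof -
  from assms(2) obtain U L where G: "graph G" and UL: "verts G = U \<union> L" "U \<inter> L = {}"
    and card: "card U = 1" "card L = n" and ends: "arcs_ends G = U \<times> L \<union> L \<times> U"
    by (auto simp: complete_bipartite_digraph_def)
  obtain x where U: "U = {x}" using card(1) by (auto simp: card_1_singleton_iff)
  have "finite L" using assms(1) card(2) by (auto intro: card_ge_0_finite)
  then have star: "star G x L" using UL U ends by unfold_locales auto
  have nonempty: "verts G \<noteq> {}" using UL U by auto
  show ?thesis
  proof (intro conjI impI)
    assume "odd n"
    then have "(n + 1) div 2 + 2 \<le> eternal_game_chromatic_number G"
      using star.wins_odd[OF star] card(2) by (intro chromatic_number_geI G nonempty) auto
    moreover have "\<lceil>real n / 2\<rceil> = int ((n + 1) div 2)"
      using \<open>odd n\<close> by (auto elim!: oddE simp: ceiling_eq_iff)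
    ultimately show "int (eternal_game_chromatic_number G) \<ge> \<lceil>real n / 2\<rceil> + 2" by linarith
  next
    assume n: "even n \<and> n \<ge> 4"
    then have "n div 2 + 3 \<le> eternal_game_chromatic_number G"
      using star.wins_even[OF star] card(2) by (intro chromatic_number_geI G nonempty) auto
    moreover have "real (n div 2) = real n / 2" using n by (simp add: real_of_nat_div)
    ultimately show "real (eternal_game_chromatic_number G) \<ge> real n / 2 + 3" by linarith
  qed
qed

end
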